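(* Let $\lambda\in\mathbb{R}\setminus\{0\}$, let $r$ be a nonnegative integer and $p$ a nonnegative integer. Then for all real $x$, $$\frac{d}{dx}y_{p,\lambda}(x,r)=y_{p,\lambda}(x,r)+e^{x}\phi_{p,\lambda}^{(r)}(x).$$
   Context: For $\lambda\neq0$, $(x)_{0,\lambda}=1$, $(x)_{n,\lambda}=x(x-\lambda)\cdots(x-(n-1)\lambda)$ for $n\ge1$; $e_{\lambda}^{x}(t)=(1+\lambda t)^{x/\lambda}$, $e_\lambda(t)=e_\lambda^1(t)$. The degenerate $r$-Bell polynomials are defined by $e_{\lambda}^{r}(t)e^{x(e_{\lambda}(t)-1)}=\sum_{n\ge0}\phi_{n,\lambda}^{(r)}(x)\frac{t^{n}}{n!}$. Define $t_{\lambda,p}(x,r)=\sum_{n=0}^{\infty}\Big(\sum_{k=0}^{n}(k+r)_{p,\lambda}\Big)\frac{x^{n}}{n!}$ and $y_{p,\lambda}(x,r)=t_{\lambda,p}(x,r)-e^{x}\phi_{p,\lambda}^{(r)}(x)$. *)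

theory Defs
  imports Complex_Main "HOL-Computational_Algebra.Formal_Power_Series"
begin

unbundle fps_syntax

definition degen_ffact :: "real \<Rightarrow> real \<Rightarrow> nat \<Rightarrow> real" where
  "degen_ffact lam x n = (\<Prod>i<n. x - real i * lam)"

text \<open>
  Generating functions are read as formal power series in \<open>t\<close>: the series
  \<open>(1 + lam t) powr (x / lam)\<close> is the binomial series \<open>(1 + X) powr c\<close> with \<open>c = x / lam\<close>
  composed with \<open>lam X\<close>.
\<close>

definition degen_exp :: "real \<Rightarrow> real \<Rightarrow> real fps" where
  "degen_exp lam x = fps_binomial (x / lam) oo (fps_const lam * fps_X)"

definition degen_rBell_gf :: "real \<Rightarrow> nat \<Rightarrow> real \<Rightarrow> real fps" where
  "degen_rBell_gf lam r x = degen_exp lam (real r) * (fps_exp x oo (degen_exp lam 1 - 1))"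

definition degen_rBell :: "real \<Rightarrow> nat \<Rightarrow> nat \<Rightarrow> real \<Rightarrow> real" where
  "degen_rBell lam r n x = fact n * degen_rBell_gf lam r x $ n"

definition t_fun :: "real \<Rightarrow> nat \<Rightarrow> real \<Rightarrow> nat \<Rightarrow> real" where
  "t_fun lam p x r =
    (\<Sum>n. (\<Sum>k\<le>n. degen_ffact lam (real (k + r)) p) * x ^ n / fact n)"

definition y_fun :: "nat \<Rightarrow> real \<Rightarrow> real \<Rightarrow> nat \<Rightarrow> real" where
  "y_fun p lam x r = t_fun lam p x r - exp x * degen_rBell lam r p x"

text \<open>Sanity check: the coefficients of \<^const>\<open>degen_exp\<close> are the degenerate falling factorials.\<close>

lemma degen_exp_nth:
  assumes "lam \<noteq> 0"
  shows "degen_exp lam x $ n = degen_ffact lam x n / fact n"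
proof -
  have "degen_ffact lam x n = (\<Prod>i<n. lam * (x / lam - real i))"
    unfolding degen_ffact_def using assms by (intro prod.cong) (auto simp: field_simps)
  also have "\<dots> = lam ^ n * (\<Prod>i<n. x / lam - real i)"
    by (simp add: prod.distrib)
  finally show ?thesis
    by (simp add: degen_exp_def fps_compose_linear gbinomial_prod_rev atLeast0LessThan)
qed

text \<open>
  The series defining \<^const>\<open>t_fun\<close> converges everywhere, so its \<^const>\<open>suminf\<close> is a genuine sum.
\<close>

lemma summable_t_fun:
  "summable (\<lambda>n. (\<Sum>k\<le>n. degen_ffact lam (real (k + r)) p) * x ^ n / fact n)"
proof -
  define C where "C = 1 + real r + real p * \<bar>lam\<bar>"
  define M where "M = \<bar>x\<bar> * exp (real p + 1)"
  have "C \<ge> 1" by (simp add: C_def)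
  have term_bound: "\<bar>degen_ffact lam (real (k + r)) p\<bar> \<le> (C * exp (real n)) ^ p" if "k \<le> n" for k n
  proof -
    have "\<bar>real (k + r) - real i * lam\<bar> \<le> C * exp (real n)" if "i < p" for i
    proof -
      have "\<bar>real (k + r) - real i * lam\<bar> \<le> real (k + r) + \<bar>real i * lam\<bar>" by linarith
      also have "\<bar>real i * lam\<bar> \<le> real p * \<bar>lam\<bar>"
        using that by (simp add: abs_mult mult_right_mono)
      also have "real (k + r) + real p * \<bar>lam\<bar> \<le> real n + (C - 1)"
        using \<open>k \<le> n\<close> by (simp add: C_def)
      also have "\<dots> \<le> C * (1 + real n)"
        using mult_right_mono[OF \<open>C \<ge> 1\<close>, of "real n"] by (simp add: algebra_simps)
      also have "\<dots> \<le> C * exp (real n)"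
        using \<open>C \<ge> 1\<close> exp_ge_add_one_self[of "real n"] by (intro mult_left_mono) auto
      finally show ?thesis by simp
    qed
    hence "(\<Prod>i<p. \<bar>real (k + r) - real i * lam\<bar>) \<le> (\<Prod>i<p. C * exp (real n))"
      by (intro prod_mono) auto
    thus ?thesis by (simp add: degen_ffact_def abs_prod)
  qed
  have "summable (\<lambda>n. C ^ p * (M ^ n / fact n))"
    using summable_exp[of M] by (intro summable_mult) (simp add: field_simps)
  thus ?thesis
  proof (rule summable_comparison_test'[where N = 0])
    fix n :: nat
    have "\<bar>\<Sum>k\<le>n. degen_ffact lam (real (k + r)) p\<bar> \<le> (\<Sum>k\<le>n. (C * exp (real n)) ^ p)"
      by (rule order_trans[OF sum_abs sum_mono]) (use term_bound in auto)
    also have "\<dots> = (1 + real n) * (C ^ p * exp (real n) ^ p)"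
      by (simp add: power_mult_distrib)
    also have "\<dots> \<le> exp (real n) * (C ^ p * exp (real n) ^ p)"
      using \<open>C \<ge> 1\<close> exp_ge_add_one_self[of "real n"] by (intro mult_right_mono) auto
    also have "\<dots> = C ^ p * exp (real p + 1) ^ n"
      by (simp add: exp_of_nat_mult [symmetric] exp_add [symmetric] algebra_simps)
    finally have "\<bar>\<Sum>k\<le>n. degen_ffact lam (real (k + r)) p\<bar> * (\<bar>x\<bar> ^ n / fact n)
        \<le> C ^ p * exp (real p + 1) ^ n * (\<bar>x\<bar> ^ n / fact n)"
      by (intro mult_right_mono) auto
    thus "norm ((\<Sum>k\<le>n. degen_ffact lam (real (k + r)) p) * x ^ n / fact n)
        \<le> C ^ p * (M ^ n / fact n)"
      by (simp add: M_def abs_mult power_abs power_mult_distrib mult_ac)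
  qed
qed

end

theory Submission imports Defs begin

text \<open>
  Expanding \<open>E\<^sup>n\<close> as \<open>(1 + (E - 1))\<^sup>n\<close>, where \<open>E\<close> is the degenerate exponential, gives the
  Dobinski formula for the degenerate \<open>r\<close>-Bell polynomials. Subtracting it from the series of
  \<open>t\<close> removes the top term of each partial sum, so \<open>y\<close> has the series of \<open>t\<close> with all
  coefficients shifted by one; differentiating \<open>y\<close> termwise gives back \<open>t\<close>.
\<close>

lemma degen_exp_add: "degen_exp lam (x + y) = degen_exp lam x * degen_exp lam y"
  by (simp add: degen_exp_def add_divide_distrib fps_binomial_add_mult fps_compose_mult_distrib)

lemma degen_exp_of_nat: "degen_exp lam (real n) = degen_exp lam 1 ^ n"
proof (induction n)
  case 0
  show ?case by (simp add: degen_exp_def)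
next
  case (Suc n)
  then show ?case using degen_exp_add[of lam 1 "real n"] by simp
qed

lemma degen_exp_nth_0: "degen_exp lam x $ 0 = 1"
  by (simp add: degen_exp_def)

text \<open>Since \<open>b ^ j\<close> has no terms of degree below \<open>j\<close>, every
  coefficient of \<open>a oo b\<close> up to degree \<open>n\<close> can be summed over the same
  range \<open>j \<le> n\<close>; the sum then commutes with the convolution with
  \<open>f\<close>.\<close>

lemma fps_mult_compose_nth:
  fixes a b f :: "'a::idom fps"
  assumes "b $ 0 = 0"
  shows "(f * (a oo b)) $ n = (\<Sum>j\<le>n. a $ j * (f * b ^ j) $ n)"
proof -
  have comp: "(a oo b) $ k = (\<Sum>j\<le>n. a $ j * (b ^ j) $ k)" if "k \<le> n" for k
    unfolding fps_compose_nth
    by (intro sum.mono_neutral_left)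
       (use that assms in \<open>auto simp: startsby_zero_power_prefix\<close>)
  have "(f * (a oo b)) $ n = (\<Sum>i\<le>n. \<Sum>j\<le>n. f $ i * (a $ j * (b ^ j) $ (n - i)))"
    unfolding fps_mult_nth atLeast0AtMost by (intro sum.cong) (simp_all add: comp sum_distrib_left)
  also have "\<dots> = (\<Sum>j\<le>n. a $ j * (f * b ^ j) $ n)"
    by (subst sum.swap) (simp add: fps_mult_nth atLeast0AtMost sum_distrib_left mult_ac)
  finally show ?thesis .
qed

lemma degen_rBell_eq_sum:
  "degen_rBell lam r p x =
     fact p * (\<Sum>j\<le>p. x ^ j / fact j * (degen_exp lam (real r) * (degen_exp lam 1 - 1) ^ j) $ p)"
  by (simp add: degen_rBell_def degen_rBell_gf_def fps_mult_compose_nth degen_exp_nth_0)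

text \<open>Same coefficients as in \<open>degen_rBell_eq_sum\<close>, with
  \<open>n choose j\<close> in place of \<open>x ^ j / fact j\<close>. The range
  \<open>j \<le> p\<close> does not depend on \<open>n\<close>, so summing over \<open>n\<close>
  later needs no interchange of infinite sums.\<close>

lemma degen_ffact_add_eq_sum:
  assumes "lam \<noteq> 0"
  shows "degen_ffact lam (real (n + r)) p =
     fact p * (\<Sum>j\<le>p. real (n choose j) * (degen_exp lam (real r) * (degen_exp lam 1 - 1) ^ j) $ p)"
proof -
  define D where "D = degen_exp lam 1 - 1"
  define F where "F = degen_exp lam (real r)"
  have "D $ 0 = 0" by (simp add: D_def degen_exp_nth_0)
  hence zero: "(F * D ^ j) $ p = 0" if "p < j" for j
    using that by (auto simp: fps_mult_nth startsby_zero_power_prefix intro!: sum.neutral)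
  have "degen_exp lam (real (n + r)) = F * (D + 1) ^ n"
    by (simp add: degen_exp_add degen_exp_of_nat F_def D_def)
  also have "\<dots> = (\<Sum>j\<le>n. fps_const (real (n choose j)) * (F * D ^ j))"
    by (simp add: binomial_ring sum_distrib_left mult_ac flip: fps_of_nat)
  finally have "degen_exp lam (real (n + r)) $ p = (\<Sum>j\<le>n. real (n choose j) * (F * D ^ j) $ p)"
    by (simp add: fps_sum_nth)
  \<comment> \<open>Either of \<open>n\<close> and \<open>p\<close> may be larger: terms with
    \<open>j > n\<close> vanish by the binomial coefficient, those with \<open>j > p\<close> because
    \<open>D ^ j\<close> starts at degree \<open>j\<close>.\<close>
  also have "\<dots> = (\<Sum>j\<le>max n p. real (n choose j) * (F * D ^ j) $ p)"
    by (intro sum.mono_neutral_left) auto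
  also have "\<dots> = (\<Sum>j\<le>p. real (n choose j) * (F * D ^ j) $ p)"
    by (intro sum.mono_neutral_right) (auto simp: zero)
  finally show ?thesis
    using assms by (simp add: degen_exp_nth F_def D_def field_simps)
qed

text \<open>As \<open>(n choose j) / fact n = 1 / (fact j * fact (n - j))\<close>, this is the
  exponential series shifted by \<open>j\<close>; the terms with \<open>n < j\<close> are
  zero.\<close>

lemma choose_exp_sums:
  "(\<lambda>n. real (n choose j) * x ^ n / fact n) sums (x ^ j / fact j * exp x)"
proof -
  have "(\<lambda>m. x ^ j / fact j * (x ^ m / fact m)) sums (x ^ j / fact j * exp x)"
    using exp_converges[of x] by (intro sums_mult) (simp add: field_simps)
  moreover have "x ^ j / fact j * (x ^ m / fact m) = real ((m + j) choose j) * x ^ (m + j) / fact (m + j)"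
    for m by (simp add: binomial_fact power_add field_simps)
  ultimately have "(\<lambda>m. real ((m + j) choose j) * x ^ (m + j) / fact (m + j))
      sums (x ^ j / fact j * exp x)" by simp
  thus ?thesis
    by (subst (asm) sums_zero_iff_shift) (auto simp: binomial_eq_0)
qed

theorem degen_rBell_Dobinski:
  assumes "lam \<noteq> 0"
  shows "(\<lambda>n. degen_ffact lam (real (n + r)) p * x ^ n / fact n)
           sums (exp x * degen_rBell lam r p x)"
proof -
  define a where "a j = (degen_exp lam (real r) * (degen_exp lam 1 - 1) ^ j) $ p" for j
  have "(\<lambda>n. \<Sum>j\<le>p. fact p * a j * (real (n choose j) * x ^ n / fact n))
      sums (\<Sum>j\<le>p. fact p * a j * (x ^ j / fact j * exp x))"
    by (intro sums_sum sums_mult choose_exp_sums)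
  also have "(\<lambda>n. \<Sum>j\<le>p. fact p * a j * (real (n choose j) * x ^ n / fact n)) =
      (\<lambda>n. degen_ffact lam (real (n + r)) p * x ^ n / fact n)"
    unfolding degen_ffact_add_eq_sum[OF assms] a_def
    by (simp add: sum_distrib_left sum_distrib_right sum_divide_distrib mult_ac)
  also have "(\<Sum>j\<le>p. fact p * a j * (x ^ j / fact j * exp x)) = exp x * degen_rBell lam r p x"
    unfolding degen_rBell_eq_sum a_def by (simp add: sum_distrib_left mult_ac)
  finally show ?thesis .
qed

lemma y_fun_sums:
  assumes "lam \<noteq> 0"
  shows "(\<lambda>n. (\<Sum>k<n. degen_ffact lam (real (k + r)) p) / fact n * x ^ n) sums y_fun p lam x r"
proof -
  have "(\<lambda>n. (\<Sum>k\<le>n. degen_ffact lam (real (k + r)) p) * x ^ n / fact n -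
          degen_ffact lam (real (n + r)) p * x ^ n / fact n) sums y_fun p lam x r"
    unfolding y_fun_def t_fun_def
    by (intro sums_diff summable_sums summable_t_fun degen_rBell_Dobinski assms)
  thus ?thesis
    by (simp add: lessThan_Suc_atMost [symmetric] algebra_simps add_divide_distrib)
qed

theorem theorem2:
  fixes lam x :: real and r p :: nat
  assumes "lam \<noteq> 0"
  shows "((\<lambda>z. y_fun p lam z r) has_real_derivative
           (y_fun p lam x r + exp x * degen_rBell lam r p x)) (at x)"
proof -
  define c where "c n = (\<Sum>k<n. degen_ffact lam (real (k + r)) p) / fact n" for n
  have sums: "(\<lambda>n. c n * z ^ n) sums y_fun p lam z r" for z
    unfolding c_def by (rule y_fun_sums[OF assms])
  \<comment> \<open>\<open>diffs c n\<close> is \<open>Suc n * c (Suc n)\<close>: the factor reduces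
    \<open>fact (Suc n)\<close> to \<open>fact n\<close>, and \<open>k < Suc n\<close> becomes
    \<open>k \<le> n\<close>, which gives the terms of \<open>t_fun\<close>.\<close>
  have "diffs c n * x ^ n = (\<Sum>k\<le>n. degen_ffact lam (real (k + r)) p) * x ^ n / fact n" for n
    by (simp add: diffs_def c_def lessThan_Suc_atMost field_simps del: sum.lessThan_Suc of_nat_Suc)
  hence "(\<Sum>n. diffs c n * x ^ n) = y_fun p lam x r + exp x * degen_rBell lam r p x"
    by (simp add: y_fun_def t_fun_def)
  moreover have "((\<lambda>z. \<Sum>n. c n * z ^ n) has_real_derivative (\<Sum>n. diffs c n * x ^ n)) (at x)"
    by (rule termdiffs_strong_converges_everywhere) (use sums in \<open>auto simp: sums_iff\<close>)
  ultimately show ?thesis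
    using sums by (simp add: sums_iff)
qed

end
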